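(* Let $G_2 = \langle g_1, g_2 \mid g_2g_1 = g_1^{-1}g_2 \rangle$. Then \[ \mathrm{Aut}(G_2) = \{ \alpha_a, \beta_a, \gamma_a, \delta_a \mid a \in \mathbb{Z} \} \quad\text{and}\quad \mathrm{Inn}(G_2) = \{ \beta_{2a}, \gamma_{2a} \mid a \in \mathbb{Z} \}, \] where \[ \alpha_a = \begin{bmatrix} 1 & a \\ 0 & -1 \end{bmatrix}, \quad \beta_a = \begin{bmatrix} -1 & a \\ 0 & 1 \end{bmatrix}, \quad \gamma_a = \begin{bmatrix} 1 & a \\ 0 & 1 \end{bmatrix}, \quad \delta_a = \begin{bmatrix} -1 & a \\ 0 & -1 \end{bmatrix}, \] with composition given by the following table (the entry in the row of $x$ and the column of $y$ is $x\circ y$), for all $a,b,c,d,a',b',c',d' \in \mathbb{Z}$: \[ \begin{array}{c|cccc} \circ & \alpha_{a'} & \beta_{b'} & \gamma_{c'} & \delta_{d'} \\ \hline \alpha_a & \gamma_{a+a'} & \delta_{a+b'} & \alpha_{a+c'} & \beta_{a+d'} \\ \beta_b & \delta_{b-a'} & \gamma_{b-b'} & \beta_{b-c'} & \alpha_{b-d'} \\ \gamma_c & \alpha_{c+a'} & \beta_{c+b'} & \gamma_{c+c'} & \delta_{c+d'} \\ \delta_d & \beta_{d-a'} & \alpha_{d-b'} & \delta_{d-c'} & \gamma_{d-d'} \end{array} \] In particular, $\mathrm{Aut}(G_2) = \langle \alpha_0, \alpha_1, \beta_0, \beta_1 \rangle$ and $\mathrm{Inn}(G_2) = \langle \alpha_1^2,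 \beta_0 \rangle$.
   Context: Every element of $G_2$ is written uniquely as $g_1^{e_1}g_2^{e_2}$ with $e_1,e_2 \in \mathbb{Z}$. Matrix notation: a $2\times 2$ integer matrix $(a_{i,j})$ denotes the map $\varphi$ of $G_2$ determined on generators by $\varphi(g_j) = g_1^{a_{1,j}} g_2^{a_{2,j}}$ for $j=1,2$ (the $j$-th column lists the exponents of the image of $g_j$). $\mathrm{Inn}(G_2)$ is the group of inner automorphisms. *)

theory Defs
  imports "HOL-Analysis.Cartesian_Space" "HOL-Algebra.Bij" "HOL-Algebra.Generated_Groups"
begin

text \<open>
  Words over an alphabet: the letter \<open>(x, True)\<close> stands for the generator \<open>x\<close> and
  \<open>(x, False)\<close> for its formal inverse.
\<close>

type_synonym 'x word = "('x \<times> bool) list"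

text \<open>
  The congruence on words generated by \<open>x x\<inverse> = x\<inverse> x = 1\<close> and the relations
  \<open>r = s\<close> for \<open>(r, s) \<in> R\<close>.  The quotient of the word monoid by it is the group
  with generators \<open>'x\<close> and defining relations \<open>R\<close>.
\<close>

inductive_set word_cong :: "('x word \<times> 'x word) set \<Rightarrow> ('x word \<times> 'x word) set"
  for R :: "('x word \<times> 'x word) set"
where
  refl: "(u, u) \<in> word_cong R"
| sym: "(u, v) \<in> word_cong R \<Longrightarrow> (v, u) \<in> word_cong R"
| trans: "(u, v) \<in> word_cong R \<Longrightarrow> (v, w) \<in> word_cong R \<Longrightarrow> (u, w) \<in> word_cong R"
| cancel: "(u @ [(x, e), (x, \<not> e)] @ v, u @ v) \<in> word_cong R"
| relation: "(r, s) \<in> R \<Longrightarrow> (u @ r @ v, u @ s @ v) \<in> word_cong R"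

definition presented_group :: "('x word \<times> 'x word) set \<Rightarrow> 'x word set monoid" where
  "presented_group R =
     \<lparr>carrier = UNIV // word_cong R,
      mult = (\<lambda>X Y. word_cong R `` {u @ v | u v. u \<in> X \<and> v \<in> Y}),
      one = word_cong R `` {[]}\<rparr>"

definition presented_gen :: "('x word \<times> 'x word) set \<Rightarrow> 'x \<Rightarrow> 'x word set" where
  "presented_gen R x = word_cong R `` {[(x, True)]}"

text \<open>
  The generators are indexed by the two-element type \<open>2\<close>, which also indexes the rows and
  columns of \<open>2 \<times> 2\<close> matrices.
\<close>

definition G2_rels :: "(2 word \<times> 2 word) set" where
  "G2_rels = {([(2, True), (1, True)], [(1, False), (2, True)])}"

definition G2 :: "2 word set monoid" where
  "G2 = presented_group G2_rels"

definition g :: "2 \<Rightarrow> 2 word set" where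
  "g j = presented_gen G2_rels j"

text \<open>
  As in \<^const>\<open>auto\<close>, maps of a group are taken to be undefined outside its carrier.
  The description below is only meaningful for matrices whose columns satisfy the defining
  relation of \<open>G2\<close>.
\<close>

definition matrix_map :: "int^2^2 \<Rightarrow> 2 word set \<Rightarrow> 2 word set" where
  "matrix_map A =
     (THE \<phi>. \<phi> \<in> hom G2 G2 \<and> \<phi> \<in> extensional (carrier G2) \<and>
        (\<forall>j. \<phi> (g j) = g 1 [^]\<^bsub>G2\<^esub> (A $ 1 $ j) \<otimes>\<^bsub>G2\<^esub> g 2 [^]\<^bsub>G2\<^esub> (A $ 2 $ j)))"

definition \<alpha> :: "int \<Rightarrow> 2 word set \<Rightarrow> 2 word set" where
  "\<alpha> a = matrix_map (vector [vector [1, a], vector [0, -1]])"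

definition \<beta> :: "int \<Rightarrow> 2 word set \<Rightarrow> 2 word set" where
  "\<beta> a = matrix_map (vector [vector [-1, a], vector [0, 1]])"

definition \<gamma> :: "int \<Rightarrow> 2 word set \<Rightarrow> 2 word set" where
  "\<gamma> a = matrix_map (vector [vector [1, a], vector [0, 1]])"

definition \<delta> :: "int \<Rightarrow> 2 word set \<Rightarrow> 2 word set" where
  "\<delta> a = matrix_map (vector [vector [-1, a], vector [0, -1]])"

definition Inn :: "('a, 'b) monoid_scheme \<Rightarrow> ('a \<Rightarrow> 'a) set" where
  "Inn G = {\<lambda>x \<in> carrier G. h \<otimes>\<^bsub>G\<^esub> x \<otimes>\<^bsub>G\<^esub> inv\<^bsub>G\<^esub> h | h. h \<in> carrier G}"

abbreviation comp_G2 ::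
  "(2 word set \<Rightarrow> 2 word set) \<Rightarrow> (2 word set \<Rightarrow> 2 word set) \<Rightarrow> 2 word set \<Rightarrow> 2 word set"
  (infixl "\<circ>\<^sub>2" 70) where
  "x \<circ>\<^sub>2 y \<equiv> compose (carrier G2) x y"

end

theory Submission
  imports Defs
begin

text \<open>
  Evaluating words in \<open>\<int> \<rtimes> \<int>\<close> shows that the products \<open>g\<^sub>1\<^sup>a g\<^sub>2\<^sup>b\<close> are pairwise distinct, so \<open>G2\<close> is
  this semidirect product.  If \<open>\<phi>\<close> is an automorphism and \<open>q\<close> is the exponent of \<open>g\<^sub>2\<close> in \<open>\<phi>(g\<^sub>1)\<close>, then
  \<open>g\<^sub>1 g\<^sub>2 g\<^sub>1 = g\<^sub>2\<close> gives \<open>2q = 0\<close>; hence \<open>\<phi>\<close> is upper triangular, and surjectivity forces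
  the diagonal entries to be \<open>\<plusminus>1\<close>.  Conjugation by \<open>g\<^sub>1\<^sup>c g\<^sub>2\<^sup>d\<close> is upper triangular with diagonal
  \<open>(-1)\<^sup>d, 1\<close> and off-diagonal entry \<open>2c\<close>.
\<close>

section \<open>Groups given by generators and relations\<close>

lemma equiv_word_cong: "equiv UNIV (word_cong R)"
  by (rule equivI)
    (auto intro: refl_onI symI transI word_cong.refl word_cong.sym word_cong.trans)

text \<open>The rules \<open>cancel\<close> and \<open>relation\<close> already carry a context on
  both sides, so a larger context is absorbed into theirs. This makes concatenation well defined on
  classes.\<close>

lemma word_cong_append:
  assumes "(u, u') \<in> word_cong R"
  shows "(w @ u @ v, w @ u' @ v) \<in> word_cong R"
  using assms
proof (induction rule: word_cong.induct)
  case (cancel u x e v')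
  then show ?case
    using word_cong.cancel[of "w @ u" x e "v' @ v" R] by simp
next
  case (relation r s u v')
  then show ?case
    using word_cong.relation[of r s R "w @ u" "v' @ v"] by simp
qed (blast intro: word_cong.intros)+

lemma word_cong_append2:
  assumes "(u, u') \<in> word_cong R" "(v, v') \<in> word_cong R"
  shows "(u @ v, u' @ v') \<in> word_cong R"
  using word_cong_append[OF assms(1), of "[]" v] word_cong_append[OF assms(2), of u' "[]"]
  by (auto intro: word_cong.trans)

definition word_class :: "('x word \<times> 'x word) set \<Rightarrow> 'x word \<Rightarrow> 'x word set" where
  "word_class R w = word_cong R `` {w}"

lemma word_class_eq_iff: "word_class R u = word_class R v \<longleftrightarrow> (u, v) \<in> word_cong R"
  unfolding word_class_def by (rule eq_equiv_class_iff[OF equiv_word_cong]) simp_all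

lemma carrier_presented_group: "carrier (presented_group R) = range (word_class R)"
  by (auto simp: presented_group_def word_class_def quotient_def)

lemma one_presented_group: "\<one>\<^bsub>presented_group R\<^esub> = word_class R []"
  by (simp add: presented_group_def word_class_def)

text \<open>The product in \<open>presented_group\<close> saturates all concatenations of
  representatives; by \<open>word_cong_append2\<close> these lie in one class, so products can be
  computed on chosen words.\<close>

lemma mult_word_class:
  "word_class R u \<otimes>\<^bsub>presented_group R\<^esub> word_class R v = word_class R (u @ v)"
proof -
  have "word_cong R `` {u' @ v' | u' v'. u' \<in> word_class R u \<and> v' \<in> word_class R v}
    = word_class R (u @ v)"
    unfolding word_class_def
    using word_cong_append2[of u _ R v]
    by (auto intro: word_cong.intros)
  then show ?thesis
    by (simp add: presented_group_def)
qed

definition inv_word :: "'x word \<Rightarrow> 'x word" where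
  "inv_word w = rev (map (\<lambda>(x, e). (x, \<not> e)) w)"

lemma inv_word_append_cong: "(inv_word w @ w, []) \<in> word_cong R"
proof (induction w)
  case Nil
  then show ?case by (simp add: inv_word_def word_cong.refl)
next
  case (Cons l w)
  obtain x e where l: "l = (x, e)" by force
  \<comment> \<open>The first letter of the word and its formal inverse meet in the middle. The
    double negation gives the pair the shape required by \<open>word_cong.cancel\<close>.\<close>
  have "inv_word (l # w) @ l # w = inv_word w @ [(x, \<not> e), (x, \<not> \<not> e)] @ w"
    by (simp add: l inv_word_def)
  then show ?case
    using Cons word_cong.cancel[of "inv_word w" x "\<not> e" w R] by (metis word_cong.trans)
qed

lemma group_presented_group: "group (presented_group R)"
proof (rule groupI)
  fix X assume "X \<in> carrier (presented_group R)"
  then show "\<exists>Y\<in>carrier (presented_group R). Y \<otimes>\<^bsub>presented_group R\<^esub> X = \<one>\<^bsub>presented_group R\<^esub>"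
    using inv_word_append_cong
    by (force simp: carrier_presented_group one_presented_group mult_word_class word_class_eq_iff)
qed (auto simp: carrier_presented_group one_presented_group mult_word_class)

lemma presented_gen_eq: "presented_gen R x = word_class R [(x, True)]"
  by (simp add: presented_gen_def word_class_def)

lemma presented_gen_closed: "presented_gen R x \<in> carrier (presented_group R)"
  by (simp add: carrier_presented_group presented_gen_eq)

lemma inv_presented_gen:
  "inv\<^bsub>presented_group R\<^esub> presented_gen R x = word_class R [(x, False)]"
proof -
  interpret group "presented_group R" by (rule group_presented_group)
  have "([(x, False), (x, True)], []) \<in> word_cong R"
    using word_cong.cancel[of "[]" x False "[]" R] by simp
  then show ?thesis
    by (intro inv_equality)
      (auto simp: presented_gen_eq carrier_presented_group one_presented_group mult_word_class
        word_class_eq_iff)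
qed

text \<open>Every class has a word, and a word is built by prepending letters; on classes this is
  left multiplication by a generator or its inverse.\<close>

lemma presented_group_induct [consumes 1, case_names one gen inv_gen]:
  assumes "X \<in> carrier (presented_group R)"
    and one: "P \<one>\<^bsub>presented_group R\<^esub>"
    and gen: "\<And>x Y. Y \<in> carrier (presented_group R) \<Longrightarrow> P Y \<Longrightarrow>
      P (presented_gen R x \<otimes>\<^bsub>presented_group R\<^esub> Y)"
    and inv_gen: "\<And>x Y. Y \<in> carrier (presented_group R) \<Longrightarrow> P Y \<Longrightarrow>
      P (inv\<^bsub>presented_group R\<^esub> presented_gen R x \<otimes>\<^bsub>presented_group R\<^esub> Y)"
  shows "P X"
proof -
  obtain w where "X = word_class R w"
    using assms(1) by (auto simp: carrier_presented_group)
  moreover have "P (word_class R w)"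
  proof (induction w)
    case Nil
    then show ?case using one by (simp add: one_presented_group)
  next
    case (Cons l w)
    obtain x e where l: "l = (x, e)" by force
    have "word_class R w \<in> carrier (presented_group R)"
      by (simp add: carrier_presented_group)
    from gen[OF this Cons, of x] inv_gen[OF this Cons, of x] show ?case
      \<comment> \<open>Inverses are rewritten first, since expanding
        \<open>presented_gen_eq\<close> would destroy the left-hand side of
        \<open>inv_presented_gen\<close>.\<close>
      unfolding inv_presented_gen unfolding presented_gen_eq mult_word_class
      by (cases e) (simp_all add: l)
  qed
  ultimately show ?thesis by simp
qed

section \<open>Evaluation of words and the universal property of a presentation\<close>

primrec eval_word :: "('a, 'b) monoid_scheme \<Rightarrow> ('x \<Rightarrow> 'a) \<Rightarrow> 'x word \<Rightarrow> 'a" where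
  "eval_word H f [] = \<one>\<^bsub>H\<^esub>"
| "eval_word H f (l # w) =
     (if snd l then f (fst l) else inv\<^bsub>H\<^esub> f (fst l)) \<otimes>\<^bsub>H\<^esub> eval_word H f w"

context group
begin

lemma eval_word_closed [simp]:
  "range f \<subseteq> carrier G \<Longrightarrow> eval_word G f w \<in> carrier G"
  by (induction w) (auto simp: image_subset_iff)

lemma eval_word_append:
  "range f \<subseteq> carrier G \<Longrightarrow> eval_word G f (u @ v) = eval_word G f u \<otimes> eval_word G f v"
  by (induction u) (auto simp: image_subset_iff m_assoc)

text \<open>Evaluation is multiplicative and respects both kinds of generating pairs: cancellations
  because each \<open>f x\<close> is invertible, relations by assumption.\<close>

lemma eval_word_cong:
  assumes "(u, v) \<in> word_cong R" and f: "range f \<subseteq> carrier G"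
    and "\<And>r s. (r, s) \<in> R \<Longrightarrow> eval_word G f r = eval_word G f s"
  shows "eval_word G f u = eval_word G f v"
  using assms(1)
proof (induction rule: word_cong.induct)
  case (cancel u x e v)
  have "f x \<in> carrier G" using f by auto
  then have "eval_word G f [(x, e), (x, \<not> e)] = \<one>" by (cases e) auto
  then show ?case by (simp only: eval_word_append[OF f] l_one eval_word_closed[OF f])
qed (auto simp: eval_word_append[OF f] assms(3))

text \<open>Von Dyck's theorem: evaluation of words descends to classes. It yields the map from
  \<open>G2\<close> to a concrete model.\<close>

lemma presented_group_lift:
  assumes f: "range f \<subseteq> carrier G"
    and rels: "\<And>r s. (r, s) \<in> R \<Longrightarrow> eval_word G f r = eval_word G f s"
  obtains h where "h \<in> hom (presented_group R) G" "\<And>x. h (presented_gen R x) = f x"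
proof
  define h where "h X = eval_word G f (SOME w. X = word_class R w)" for X
  have h: "h (word_class R w) = eval_word G f w" for w
  proof -
    have "word_class R w = word_class R (SOME v. word_class R w = word_class R v)"
      by (rule someI) (rule HOL.refl)
    then show ?thesis
      unfolding h_def word_class_eq_iff by (rule eval_word_cong[OF _ f rels, symmetric])
  qed
  show "h \<in> hom (presented_group R) G"
    by (rule homI)
      (auto simp: carrier_presented_group h mult_word_class eval_word_append[OF f] f)
  show "h (presented_gen R x) = f x" for x
    using f by (simp add: presented_gen_eq h image_subset_iff)
qed

end

section \<open>Normal forms\<close>

text \<open>This is (-1)^b for integers b of either sign: the action of \<open>g 2\<close> to the
  power b on powers of \<open>g 1\<close> by conjugation.\<close>

definition parity_sign :: "int \<Rightarrow> int" where
  "parity_sign b = (if even b then 1 else -1)"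

text \<open>The semidirect product \<open>\<int> \<rtimes> \<int>\<close>; the pair \<open>(a, b)\<close> stands for \<open>g\<^sub>1\<^sup>a g\<^sub>2\<^sup>b\<close>.\<close>

definition klein :: "(int \<times> int) monoid" where
  "klein = \<lparr>carrier = UNIV,
     mult = (\<lambda>(a, b) (c, d). (a + parity_sign b * c, b + d)), one = (0, 0)\<rparr>"

lemma klein_simps [simp]:
  "carrier klein = UNIV" "\<one>\<^bsub>klein\<^esub> = (0, 0)"
  "(a, b) \<otimes>\<^bsub>klein\<^esub> (c, d) = (a + parity_sign b * c, b + d)"
  by (simp_all add: klein_def)

lemma group_klein: "group klein"
proof (rule groupI)
  fix x :: "int \<times> int"
  show "\<exists>y\<in>carrier klein. y \<otimes>\<^bsub>klein\<^esub> x = \<one>\<^bsub>klein\<^esub>"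
    \<comment> \<open>Since -b has the parity of b, a left inverse (y, -b) of (a, b) must satisfy y
      + (-1)^b a = 0.\<close>
    by (cases x, rule bexI[of _ "(- parity_sign (snd x) * fst x, - snd x)"])
      (auto simp: parity_sign_def)
qed (auto simp: parity_sign_def)

interpretation klein: group klein by (rule group_klein)

lemma inv_klein: "inv\<^bsub>klein\<^esub> (a, b) = (- parity_sign b * a, - b)"
  by (rule klein.inv_equality) (auto simp: parity_sign_def)

lemma klein_int_pow: "(1, 0) [^]\<^bsub>klein\<^esub> (n::int) = (n, 0)" "(0, 1) [^]\<^bsub>klein\<^esub> (n::int) = (0, n)"
proof -
  have nat: "(1, 0) [^]\<^bsub>klein\<^esub> (k::nat) = (int k, 0)" "(0, 1) [^]\<^bsub>klein\<^esub> (k::nat) = (0, int k)" for k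
    by (induction k) (auto simp: parity_sign_def)
  show "(1, 0) [^]\<^bsub>klein\<^esub> n = (n, 0)" "(0, 1) [^]\<^bsub>klein\<^esub> n = (0, n)"
    by (cases n rule: int_cases2;
        simp add: int_pow_int klein.int_pow_neg_int nat inv_klein parity_sign_def)+
qed

section \<open>Rewriting elements of \<open>G2\<close> as a power of \<open>g 1\<close> times a
  power of \<open>g 2\<close>\<close>

interpretation G2: group G2
  unfolding G2_def by (rule group_presented_group)

lemma g_closed [simp]: "g j \<in> carrier G2"
  by (simp add: G2_def g_def presented_gen_closed)

lemma two_cases: "(x::2) = 1 \<or> x = 2"
  using exhaust_2 by blast

lemma G2_relation: "g 2 \<otimes>\<^bsub>G2\<^esub> g 1 = inv\<^bsub>G2\<^esub> g 1 \<otimes>\<^bsub>G2\<^esub> g 2"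
  using word_cong.relation[of _ _ G2_rels "[]" "[]"]
  unfolding G2_def g_def inv_presented_gen
  by (simp add: presented_gen_eq mult_word_class word_class_eq_iff G2_rels_def)

text \<open>Conjugation by \<open>g 2\<close> inverts \<open>g 1\<close>, hence every power of it.
  The induction runs both ways from 0, as the exponent may be negative.\<close>

lemma g2_g1_pow: "g 2 \<otimes>\<^bsub>G2\<^esub> g 1 [^]\<^bsub>G2\<^esub> (a::int) = g 1 [^]\<^bsub>G2\<^esub> (- a) \<otimes>\<^bsub>G2\<^esub> g 2"
proof -
  \<comment> \<open>The relation in the form needed for the downward half of the induction.\<close>
  have *: "g 2 \<otimes>\<^bsub>G2\<^esub> inv\<^bsub>G2\<^esub> g 1 = g 1 \<otimes>\<^bsub>G2\<^esub> g 2"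
    using G2_relation by (metis G2.inv_closed G2.inv_solve_left G2.inv_solve_right' G2.m_assoc
        G2.m_closed g_closed)
  show ?thesis
  proof (induction a rule: int_induct[of _ 0])
    case base
    then show ?case by simp
  next
    case (step1 i)
    have "g 2 \<otimes>\<^bsub>G2\<^esub> g 1 [^]\<^bsub>G2\<^esub> (i + 1) = g 1 [^]\<^bsub>G2\<^esub> (- i) \<otimes>\<^bsub>G2\<^esub> (g 2 \<otimes>\<^bsub>G2\<^esub> g 1)"
      by (simp add: G2.int_pow_mult step1 flip: G2.m_assoc)
    also have "\<dots> = g 1 [^]\<^bsub>G2\<^esub> (- i) \<otimes>\<^bsub>G2\<^esub> g 1 [^]\<^bsub>G2\<^esub> (-1::int) \<otimes>\<^bsub>G2\<^esub> g 2"
      by (simp add: G2_relation G2.m_assoc G2.int_pow_neg)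
    also have "\<dots> = g 1 [^]\<^bsub>G2\<^esub> (- (i + 1)) \<otimes>\<^bsub>G2\<^esub> g 2"
      by (simp only: G2.int_pow_mult[symmetric] g_closed) (simp add: algebra_simps)
    finally show ?case .
  next
    case (step2 i)
    have "g 2 \<otimes>\<^bsub>G2\<^esub> g 1 [^]\<^bsub>G2\<^esub> (i - 1) = g 2 \<otimes>\<^bsub>G2\<^esub> (g 1 [^]\<^bsub>G2\<^esub> i \<otimes>\<^bsub>G2\<^esub> g 1 [^]\<^bsub>G2\<^esub> (-1::int))"
      by (simp only: G2.int_pow_mult[symmetric] g_closed) simp
    also have "\<dots> = g 1 [^]\<^bsub>G2\<^esub> (- i) \<otimes>\<^bsub>G2\<^esub> (g 2 \<otimes>\<^bsub>G2\<^esub> inv\<^bsub>G2\<^esub> g 1)"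
      by (simp add: step2 G2.int_pow_neg flip: G2.m_assoc)
    also have "\<dots> = g 1 [^]\<^bsub>G2\<^esub> (- i) \<otimes>\<^bsub>G2\<^esub> g 1 [^]\<^bsub>G2\<^esub> (1::int) \<otimes>\<^bsub>G2\<^esub> g 2"
      by (simp add: * G2.m_assoc)
    also have "\<dots> = g 1 [^]\<^bsub>G2\<^esub> (- (i - 1)) \<otimes>\<^bsub>G2\<^esub> g 2"
      by (simp only: G2.int_pow_mult[symmetric] g_closed) (simp add: algebra_simps)
    finally show ?case .
  qed
qed

text \<open>Inversion of powers is its own inverse, so conjugating back by \<open>g 2\<close> has
  the same effect: \<open>g2_g1_pow\<close> is used at exponent -a and \<open>g 2\<close>
  cancelled.\<close>

lemma inv_g2_g1_pow:
  "inv\<^bsub>G2\<^esub> g 2 \<otimes>\<^bsub>G2\<^esub> g 1 [^]\<^bsub>G2\<^esub> (a::int) = g 1 [^]\<^bsub>G2\<^esub> (- a) \<otimes>\<^bsub>G2\<^esub> inv\<^bsub>G2\<^esub> g 2"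
proof -
  have "inv\<^bsub>G2\<^esub> g 2 \<otimes>\<^bsub>G2\<^esub> g 1 [^]\<^bsub>G2\<^esub> a
      = inv\<^bsub>G2\<^esub> g 2 \<otimes>\<^bsub>G2\<^esub> (g 1 [^]\<^bsub>G2\<^esub> a \<otimes>\<^bsub>G2\<^esub> g 2) \<otimes>\<^bsub>G2\<^esub> inv\<^bsub>G2\<^esub> g 2"
    by (simp add: G2.m_assoc)
  also have "\<dots> = inv\<^bsub>G2\<^esub> g 2 \<otimes>\<^bsub>G2\<^esub> (g 2 \<otimes>\<^bsub>G2\<^esub> g 1 [^]\<^bsub>G2\<^esub> (- a)) \<otimes>\<^bsub>G2\<^esub> inv\<^bsub>G2\<^esub> g 2"
    by (simp add: g2_g1_pow)
  also have "\<dots> = g 1 [^]\<^bsub>G2\<^esub> (- a) \<otimes>\<^bsub>G2\<^esub> inv\<^bsub>G2\<^esub> g 2"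
    by (simp flip: G2.m_assoc)
  finally show ?thesis .
qed

definition normal_form :: "int \<Rightarrow> int \<Rightarrow> 2 word set" where
  "normal_form a b = g 1 [^]\<^bsub>G2\<^esub> a \<otimes>\<^bsub>G2\<^esub> g 2 [^]\<^bsub>G2\<^esub> b"

lemma normal_form_closed [simp]: "normal_form a b \<in> carrier G2"
  by (simp add: normal_form_def)

text \<open>The normal forms contain the identity and are stable under left multiplication by
  generators and their inverses, so \<open>presented_group_induct\<close> reaches every
  element.\<close>

lemma normal_form_exists:
  assumes "X \<in> carrier G2"
  obtains a b where "X = normal_form a b"
proof -
  have pow: "x [^]\<^bsub>G2\<^esub> (m::int) \<otimes>\<^bsub>G2\<^esub> (x [^]\<^bsub>G2\<^esub> (n::int) \<otimes>\<^bsub>G2\<^esub> y) = x [^]\<^bsub>G2\<^esub> (m + n) \<otimes>\<^bsub>G2\<^esub> y"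
    if "x \<in> carrier G2" "y \<in> carrier G2" for x y m n
    using that by (simp add: G2.int_pow_mult G2.m_assoc)
  have g1: "g 1 \<otimes>\<^bsub>G2\<^esub> normal_form a b = normal_form (1 + a) b"
    "inv\<^bsub>G2\<^esub> g 1 \<otimes>\<^bsub>G2\<^esub> normal_form a b = normal_form (- 1 + a) b" for a b
    using pow[of "g 1" "g 2 [^]\<^bsub>G2\<^esub> b" 1 a] pow[of "g 1" "g 2 [^]\<^bsub>G2\<^esub> b" "-1" a]
    by (simp_all add: normal_form_def G2.int_pow_neg)
  have g2: "g 2 \<otimes>\<^bsub>G2\<^esub> normal_form a b = normal_form (- a) (1 + b)"
    "inv\<^bsub>G2\<^esub> g 2 \<otimes>\<^bsub>G2\<^esub> normal_form a b = normal_form (- a) (- 1 + b)" for a b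
    using pow[of "g 2" "\<one>\<^bsub>G2\<^esub>" 1 b] pow[of "g 2" "\<one>\<^bsub>G2\<^esub>" "-1" b]
    by (simp_all add: normal_form_def g2_g1_pow inv_g2_g1_pow G2.m_assoc G2.int_pow_neg
        flip: G2.m_assoc[of _ "g 1 [^]\<^bsub>G2\<^esub> a"])
  have "\<exists>a b. X = normal_form a b"
    using assms unfolding G2_def
  proof (induction rule: presented_group_induct)
    case one
    then show ?case
      by (intro exI[of _ 0]) (simp add: normal_form_def flip: G2_def)
  next
    case (gen x Y)
    then show ?case
      using two_cases[of x] g1(1) g2(1) unfolding g_def G2_def by metis
  next
    case (inv_gen x Y)
    then show ?case
      using two_cases[of x] g1(2) g2(2) unfolding g_def G2_def by metis
  qed
  then show ?thesis using that by blast
qed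

lemma hom_normal_form:
  assumes "group H" "\<phi> \<in> hom G2 H"
  shows "\<phi> (normal_form a b) = \<phi> (g 1) [^]\<^bsub>H\<^esub> a \<otimes>\<^bsub>H\<^esub> \<phi> (g 2) [^]\<^bsub>H\<^esub> b"
proof -
  interpret group_hom G2 H \<phi>
    using assms by (simp add: group_hom_def group_hom_axioms_def)
  show ?thesis by (simp add: normal_form_def hom_int_pow)
qed

text \<open>The assignment of (1, 0) and (0, 1) to \<open>g 1\<close> and \<open>g 2\<close>
  respects the relation, as both sides become (-1, 1). The induced map reads off the exponents of a
  normal form, which are therefore unique.\<close>

lemma klein_hom:
  obtains V where "V \<in> hom G2 klein" "\<And>a b. V (normal_form a b) = (a, b)"
proof -
  define f :: "2 \<Rightarrow> int \<times> int" where "f j = (if j = 1 then (1, 0) else (0, 1))" for j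
  obtain h where h: "h \<in> hom G2 klein" "\<And>x. h (g x) = f x"
    by (rule klein.presented_group_lift[of f G2_rels])
      (auto simp: G2_rels_def f_def inv_klein parity_sign_def G2_def g_def)
  have "h (normal_form a b) = (a, b)" for a b
    by (simp add: hom_normal_form[OF group_klein h(1)] h(2) f_def klein_int_pow parity_sign_def)
  with h(1) show ?thesis by (rule that)
qed

lemma normal_form_eq_iff [simp]: "normal_form a b = normal_form c d \<longleftrightarrow> a = c \<and> b = d"
  by (metis klein_hom prod.inject)

text \<open>No rewriting of words is needed: the product is some normal form, and its exponents are
  found by computing in \<open>klein\<close>.\<close>

lemma normal_form_mult [simp]:
  "normal_form a b \<otimes>\<^bsub>G2\<^esub> normal_form c d = normal_form (a + parity_sign b * c) (b + d)"
proof -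
  obtain V where V: "V \<in> hom G2 klein" "\<And>a b. V (normal_form a b) = (a, b)"
    by (rule klein_hom) blast
  obtain x y where xy: "normal_form a b \<otimes>\<^bsub>G2\<^esub> normal_form c d = normal_form x y"
    by (rule normal_form_exists[of "normal_form a b \<otimes>\<^bsub>G2\<^esub> normal_form c d"]) auto
  have "(x, y) = V (normal_form a b \<otimes>\<^bsub>G2\<^esub> normal_form c d)"
    by (simp add: V(2) xy)
  also have "\<dots> = (a, b) \<otimes>\<^bsub>klein\<^esub> (c, d)"
    by (simp add: hom_mult[OF V(1)] V(2))
  finally show ?thesis by (simp add: xy)
qed

lemma normal_form_one: "\<one>\<^bsub>G2\<^esub> = normal_form 0 0"
  by (simp add: normal_form_def)

lemma normal_form_inv: "inv\<^bsub>G2\<^esub> normal_form a b = normal_form (- parity_sign b * a) (- b)"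
  by (rule G2.inv_equality) (auto simp: normal_form_one parity_sign_def)

lemma g_normal_form: "g 1 = normal_form 1 0" "g 2 = normal_form 0 1"
  by (simp_all add: normal_form_def)

lemma G2_ext:
  assumes "\<phi> \<in> extensional (carrier G2)" "\<psi> \<in> extensional (carrier G2)"
    and "\<And>a b. \<phi> (normal_form a b) = \<psi> (normal_form a b)"
  shows "\<phi> = \<psi>"
  using assms by (metis extensionalityI normal_form_exists)

section \<open>Endomorphisms given by upper triangular matrices\<close>

abbreviation tri_map :: "int \<Rightarrow> int \<Rightarrow> int \<Rightarrow> 2 word set \<Rightarrow> 2 word set" where
  "tri_map p r s \<equiv> matrix_map (vector [vector [p, r], vector [0, s]])"

text \<open>
  The case distinction on the parity of \<open>b\<close> below comes from \<open>(g\<^sub>1\<^sup>r g\<^sub>2\<^sup>s)\<^sup>2 = g\<^sub>2\<^sup>2\<^sup>s\<close> for odd \<open>s\<close>.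
\<close>

lemma tri_map_unique:
  assumes "odd s"
  shows "\<exists>!\<phi>. \<phi> \<in> hom G2 G2 \<and> \<phi> \<in> extensional (carrier G2) \<and>
      \<phi> (g 1) = normal_form p 0 \<and> \<phi> (g 2) = normal_form r s"
    and "\<lbrakk>\<phi> \<in> hom G2 G2; \<phi> \<in> extensional (carrier G2);
      \<phi> (g 1) = normal_form p 0; \<phi> (g 2) = normal_form r s\<rbrakk> \<Longrightarrow>
      \<phi> (normal_form a b) = normal_form (p * a + (if even b then 0 else r)) (s * b)"
proof -
  \<comment> \<open>Uniqueness of normal forms makes this description of the exponent pair
    meaningful.\<close>
  define V where "V X = (THE x. X = normal_form (fst x) (snd x))" for X
  have V: "V (normal_form a b) = (a, b)" for a b
    unfolding V_def by (rule the_equality) auto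
  define \<psi> where "\<psi> = (\<lambda>X\<in>carrier G2. case V X of
    (a, b) \<Rightarrow> normal_form (p * a + (if even b then 0 else r)) (s * b))"
  have \<psi>: "\<psi> (normal_form a b) = normal_form (p * a + (if even b then 0 else r)) (s * b)" for a b
    by (simp add: \<psi>_def V)
  have hom: "\<psi> \<in> hom G2 G2"
  proof (rule homI)
    fix X Y assume "X \<in> carrier G2" "Y \<in> carrier G2"
    then obtain a b c d where "X = normal_form a b" "Y = normal_form c d"
      by (metis normal_form_exists)
    \<comment> \<open>As s is odd, s * b and b have the same parity, so the signs on the two sides
      agree in all four cases.\<close>
    with \<open>odd s\<close> show "\<psi> (X \<otimes>\<^bsub>G2\<^esub> Y) = \<psi> X \<otimes>\<^bsub>G2\<^esub> \<psi> Y"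
      by (cases "even b"; cases "even d") (simp_all add: \<psi> parity_sign_def algebra_simps)
  qed (auto simp: \<psi>_def split: prod.split)
  have ext: "\<psi> \<in> extensional (carrier G2)"
    by (simp add: \<psi>_def)
  have gens: "\<psi> (g 1) = normal_form p 0" "\<psi> (g 2) = normal_form r s"
    by (simp_all add: g_normal_form \<psi>)
  have uniq: "\<phi> = \<psi>" if "\<phi> \<in> hom G2 G2" "\<phi> \<in> extensional (carrier G2)"
    "\<phi> (g 1) = normal_form p 0" "\<phi> (g 2) = normal_form r s" for \<phi>
  proof (rule G2_ext)
    show "\<phi> (normal_form a b) = \<psi> (normal_form a b)" for a b
      by (simp only: hom_normal_form[OF G2.group_axioms that(1)]
          hom_normal_form[OF G2.group_axioms hom] that(3,4) gens)
  qed (fact that(2) ext)+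
  show "\<exists>!\<phi>. \<phi> \<in> hom G2 G2 \<and> \<phi> \<in> extensional (carrier G2) \<and>
      \<phi> (g 1) = normal_form p 0 \<and> \<phi> (g 2) = normal_form r s"
    by (rule ex1I[of _ \<psi>]) (simp_all only: hom ext gens, blast intro: uniq)
  show "\<phi> (normal_form a b) = normal_form (p * a + (if even b then 0 else r)) (s * b)"
    if "\<phi> \<in> hom G2 G2" "\<phi> \<in> extensional (carrier G2)"
    "\<phi> (g 1) = normal_form p 0" "\<phi> (g 2) = normal_form r s"
    using uniq[OF that] \<psi> by simp
qed

lemma tri_map_eq_The: "tri_map p r s = (THE \<phi>. \<phi> \<in> hom G2 G2 \<and> \<phi> \<in> extensional (carrier G2) \<and>
      \<phi> (g 1) = normal_form p 0 \<and> \<phi> (g 2) = normal_form r s)"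
  by (simp add: matrix_map_def forall_2 normal_form_def)

text \<open>For odd s, conjugation by the image of \<open>g 2\<close> inverts powers of
  \<open>g 1\<close>, so the columns respect the defining relation and the \<open>THE\<close> in
  \<open>matrix_map\<close> denotes an actual endomorphism.\<close>

lemma
  assumes "odd s"
  shows tri_map_hom: "tri_map p r s \<in> hom G2 G2"
    and tri_map_extensional: "tri_map p r s \<in> extensional (carrier G2)"
    and tri_map_normal_form: "tri_map p r s (normal_form a b) =
      normal_form (p * a + (if even b then 0 else r)) (s * b)"
    and tri_map_eqI: "\<lbrakk>\<phi> \<in> hom G2 G2; \<phi> \<in> extensional (carrier G2);
      \<phi> (g 1) = normal_form p 0; \<phi> (g 2) = normal_form r s\<rbrakk> \<Longrightarrow> \<phi> = tri_map p r s"
proof -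
  note * = theI'[OF tri_map_unique(1)[OF assms, of p r], folded tri_map_eq_The]
  show "tri_map p r s \<in> hom G2 G2" "tri_map p r s \<in> extensional (carrier G2)"
    using * by auto
  show "tri_map p r s (normal_form a b) =
      normal_form (p * a + (if even b then 0 else r)) (s * b)"
    by (rule tri_map_unique(2)[OF assms]) (use * in auto)
  show "\<phi> = tri_map p r s" if "\<phi> \<in> hom G2 G2" "\<phi> \<in> extensional (carrier G2)"
      "\<phi> (g 1) = normal_form p 0" "\<phi> (g 2) = normal_form r s"
    unfolding tri_map_eq_The
    by (rule the1_equality[OF tri_map_unique(1)[OF assms], symmetric]) (simp add: that)
qed

text \<open>This is not the matrix product, whose corner would be p r' + r s': an odd power s' of
  the second column of the left factor has \<open>g 1\<close>-exponent r, not r s'.\<close>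

lemma tri_map_compose:
  assumes "odd s" "odd s'"
  shows "tri_map p r s \<circ>\<^sub>2 tri_map p' r' s' = tri_map (p * p') (p * r' + r) (s * s')"
proof (rule G2_ext)
  have "odd (s * s')" using assms by simp
  then show "(tri_map p r s \<circ>\<^sub>2 tri_map p' r' s') (normal_form a b) =
      tri_map (p * p') (p * r' + r) (s * s') (normal_form a b)" for a b
    using assms
    by (cases "even b") (simp_all add: compose_eq tri_map_normal_form algebra_simps)
  show "tri_map (p * p') (p * r' + r) (s * s') \<in> extensional (carrier G2)"
    using \<open>odd (s * s')\<close> by (rule tri_map_extensional)
qed (simp add: compose_def)

lemma tri_map_one: "tri_map 1 0 1 = (\<lambda>x\<in>carrier G2. x)"
  by (rule G2_ext) (auto simp: tri_map_extensional tri_map_normal_form)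

lemma tri_map_auto:
  assumes "\<bar>p\<bar> = 1" "\<bar>s\<bar> = 1"
  shows "tri_map p r s \<in> auto G2"
proof -
  have odd: "odd s" using assms by (auto simp: abs_if split: if_splits)
  have p: "p = 1 \<or> p = -1" and s: "s = 1 \<or> s = -1" using assms by linarith+
  \<comment> \<open>The candidate inverse comes from \<open>tri_map_compose\<close>: p (- p r) + r =
    0 because p p = 1, and likewise s s = 1.\<close>
  have "tri_map p (- p * r) s (tri_map p r s (normal_form a b)) = normal_form a b"
    "tri_map p r s (tri_map p (- p * r) s (normal_form a b)) = normal_form a b" for a b
    using p s by (auto simp: tri_map_normal_form[OF odd])
  then have "\<forall>X\<in>carrier G2. tri_map p (- p * r) s (tri_map p r s X) = X"
    "\<forall>X\<in>carrier G2. tri_map p r s (tri_map p (- p * r) s X) = X"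
    by (metis normal_form_exists)+
  then have "bij_betw (tri_map p r s) (carrier G2) (carrier G2)"
    by (rule bij_betw_byWitness) (use hom_in_carrier[OF tri_map_hom[OF odd]] in auto)
  then show ?thesis
    using tri_map_hom[OF odd] tri_map_extensional[OF odd] by (simp add: auto_def Bij_def)
qed

section \<open>Every automorphism is upper triangular\<close>

lemma normal_form_pow_snd:
  obtains x where "normal_form r s [^]\<^bsub>G2\<^esub> (b::int) = normal_form x (s * b)"
proof -
  \<comment> \<open>Only the exponent of \<open>g 2\<close> is tracked: it is additive under
    multiplication, whereas the other exponent depends on parities and is left existential.\<close>
  have nat: "\<exists>x. normal_form r s [^]\<^bsub>G2\<^esub> n = normal_form x (s * int n)" for n :: nat
  proof (induction n)
    case 0
    show ?case by (rule exI[of _ 0]) (simp add: normal_form_one)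
  next
    case (Suc n)
    then obtain x where x: "normal_form r s [^]\<^bsub>G2\<^esub> n = normal_form x (s * int n)" ..
    show ?case
      by (rule exI[of _ "x + parity_sign (s * int n) * r"]) (simp add: x distrib_left add.commute)
  qed
  show ?thesis
  proof (cases b rule: int_cases2)
    case (nonneg n)
    obtain x where "normal_form r s [^]\<^bsub>G2\<^esub> n = normal_form x (s * int n)"
      using nat by blast
    then show ?thesis by (intro that[of x]) (simp add: nonneg int_pow_int)
  next
    case (nonpos n)
    obtain x where "normal_form r s [^]\<^bsub>G2\<^esub> n = normal_form x (s * int n)"
      using nat by blast
    then show ?thesis
      by (intro that[of "- parity_sign (s * int n) * x"])
        (simp add: nonpos G2.int_pow_neg_int normal_form_inv)
  qed
qed

lemma auto_tri_map:
  assumes "\<phi> \<in> auto G2"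
  obtains p r s where "\<bar>p\<bar> = 1" "\<bar>s\<bar> = 1" "\<phi> = tri_map p r s"
proof -
  have hom: "\<phi> \<in> hom G2 G2" and ext: "\<phi> \<in> extensional (carrier G2)"
    and surj: "\<phi> ` carrier G2 = carrier G2"
    using assms by (auto simp: auto_def Bij_def bij_betw_def)
  have "\<phi> (g j) \<in> carrier G2" for j using hom by (simp add: hom_def Pi_def)
  then obtain p q r s where pq: "\<phi> (g 1) = normal_form p q" and rs: "\<phi> (g 2) = normal_form r s"
    by (metis normal_form_exists)
  have "g 1 \<otimes>\<^bsub>G2\<^esub> g 2 \<otimes>\<^bsub>G2\<^esub> g 1 = g 2"
    by (simp add: g_normal_form parity_sign_def)
  then have "\<phi> (g 1) \<otimes>\<^bsub>G2\<^esub> \<phi> (g 2) \<otimes>\<^bsub>G2\<^esub> \<phi> (g 1) = \<phi> (g 2)"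
    using hom_mult[OF hom] by (metis G2.m_closed g_closed)
  then have q: "q = 0" by (simp add: pq rs)
  have preimage: "\<exists>a b. \<phi> (normal_form a b) = normal_form c d" for c d
    using surj normal_form_closed[of c d] by (metis imageE normal_form_exists)
  \<comment> \<open>For a preimage of \<open>g 2\<close>, the image of \<open>g 1\<close>
    contributes nothing to the second exponent. This makes s a unit, and the explicit formula for
    odd s becomes available.\<close>
  obtain a b where ab: "\<phi> (normal_form a b) = normal_form 0 1"
    using preimage by blast
  obtain x where "\<phi> (g 1) [^]\<^bsub>G2\<^esub> a = normal_form x 0"
    using normal_form_pow_snd[of p 0 a] by (auto simp: pq q)
  moreover obtain y where "\<phi> (g 2) [^]\<^bsub>G2\<^esub> b = normal_form y (s * b)"
    using normal_form_pow_snd[of r s b] by (auto simp: rs)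
  ultimately have "s * b = 1"
    using ab by (simp add: hom_normal_form[OF G2.group_axioms hom])
  then have s: "\<bar>s\<bar> = 1" using abs_zmult_eq_1[of s b] by simp
  then have odd: "odd s" by (auto simp: abs_if split: if_splits)
  have \<phi>: "\<phi> = tri_map p r s"
    using tri_map_eqI[OF odd hom ext] pq rs q by simp
  \<comment> \<open>For a preimage of \<open>g 1\<close>, s * b = 0 forces b = 0, so the parity term
    vanishes and p is a unit.\<close>
  obtain a b where "\<phi> (normal_form a b) = normal_form 1 0"
    using preimage by blast
  then have "p * a = 1" using s by (auto simp: \<phi> tri_map_normal_form[OF odd])
  then have "\<bar>p\<bar> = 1" using abs_zmult_eq_1[of p a] by simp
  then show ?thesis using s \<phi> by (rule that)
qed

section \<open>The automorphism group\<close>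

lemmas family_defs = \<alpha>_def \<beta>_def \<gamma>_def \<delta>_def

text \<open>The four families are the four choices of diagonal signs (p, s): (1, -1), (-1, 1), (1,
  1), (-1, -1).\<close>

lemma carrier_AutoGroup_G2:
  "carrier (AutoGroup G2) = range \<alpha> \<union> range \<beta> \<union> range \<gamma> \<union> range \<delta>"
proof
  show "carrier (AutoGroup G2) \<subseteq> range \<alpha> \<union> range \<beta> \<union> range \<gamma> \<union> range \<delta>"
  proof
    fix \<phi> assume "\<phi> \<in> carrier (AutoGroup G2)"
    then have "\<phi> \<in> auto G2" by (simp add: AutoGroup_def)
    then obtain p r s where "\<bar>p\<bar> = 1" "\<bar>s\<bar> = 1" and \<phi>: "\<phi> = tri_map p r s"
      by (rule auto_tri_map)
    then have "p = 1 \<or> p = -1" "s = 1 \<or> s = -1" by linarith+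
    then have "\<phi> = \<alpha> r \<or> \<phi> = \<beta> r \<or> \<phi> = \<gamma> r \<or> \<phi> = \<delta> r"
      by (elim disjE) (simp_all only: \<phi> family_defs simp_thms)
    then show "\<phi> \<in> range \<alpha> \<union> range \<beta> \<union> range \<gamma> \<union> range \<delta>"
      by (elim disjE) simp_all
  qed
  have "\<alpha> a \<in> auto G2" "\<beta> a \<in> auto G2" "\<gamma> a \<in> auto G2" "\<delta> a \<in> auto G2" for a
    unfolding family_defs by (rule tri_map_auto; simp)+
  then show "range \<alpha> \<union> range \<beta> \<union> range \<gamma> \<union> range \<delta> \<subseteq> carrier (AutoGroup G2)"
    by (auto simp: AutoGroup_def)
qed

lemma family_closed:
  "\<alpha> a \<in> carrier (AutoGroup G2)" "\<beta> a \<in> carrier (AutoGroup G2)"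
  "\<gamma> a \<in> carrier (AutoGroup G2)" "\<delta> a \<in> carrier (AutoGroup G2)"
  by (auto simp: carrier_AutoGroup_G2)

text \<open>By \<open>tri_map_compose\<close> the right index is multiplied by the upper left entry
  of the left factor: 1 for \<alpha> and \<gamma>, -1 for \<beta> and \<delta>.\<close>

lemma family_compose:
  "\<alpha> a \<circ>\<^sub>2 \<alpha> b = \<gamma> (a + b)" "\<alpha> a \<circ>\<^sub>2 \<beta> b = \<delta> (a + b)" "\<alpha> a \<circ>\<^sub>2 \<gamma> b = \<alpha> (a + b)" "\<alpha> a \<circ>\<^sub>2 \<delta> b = \<beta> (a + b)"
  "\<beta> a \<circ>\<^sub>2 \<alpha> b = \<delta> (a - b)" "\<beta> a \<circ>\<^sub>2 \<beta> b = \<gamma> (a - b)" "\<beta> a \<circ>\<^sub>2 \<gamma> b = \<beta> (a - b)" "\<beta> a \<circ>\<^sub>2 \<delta> b = \<alpha> (a - b)"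
  "\<gamma> a \<circ>\<^sub>2 \<alpha> b = \<alpha> (a + b)" "\<gamma> a \<circ>\<^sub>2 \<beta> b = \<beta> (a + b)" "\<gamma> a \<circ>\<^sub>2 \<gamma> b = \<gamma> (a + b)" "\<gamma> a \<circ>\<^sub>2 \<delta> b = \<delta> (a + b)"
  "\<delta> a \<circ>\<^sub>2 \<alpha> b = \<beta> (a - b)" "\<delta> a \<circ>\<^sub>2 \<beta> b = \<alpha> (a - b)" "\<delta> a \<circ>\<^sub>2 \<gamma> b = \<delta> (a - b)" "\<delta> a \<circ>\<^sub>2 \<delta> b = \<gamma> (a - b)"
  by (simp_all add: family_defs tri_map_compose add.commute)

interpretation Aut: group "AutoGroup G2"
  by (rule G2.AutoGroup)

lemma AutoGroup_mult:
  assumes "\<phi> \<in> carrier (AutoGroup G2)" "\<psi> \<in> carrier (AutoGroup G2)"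
  shows "\<phi> \<otimes>\<^bsub>AutoGroup G2\<^esub> \<psi> = \<phi> \<circ>\<^sub>2 \<psi>"
  using assms by (simp add: AutoGroup_def BijGroup_def auto_def)

lemmas family_mult = AutoGroup_mult family_closed family_compose

lemma AutoGroup_one: "\<one>\<^bsub>AutoGroup G2\<^esub> = \<gamma> 0"
  by (simp add: AutoGroup_def BijGroup_def \<gamma>_def tri_map_one)

lemma inv_family: "inv\<^bsub>AutoGroup G2\<^esub> \<beta> a = \<beta> a" "inv\<^bsub>AutoGroup G2\<^esub> \<gamma> a = \<gamma> (- a)"
  by (auto intro!: Aut.inv_equality simp: family_mult AutoGroup_one family_closed)

section \<open>Inner automorphisms\<close>

lemma Inn_G2: "Inn G2 = {\<beta> (2 * a) | a. True} \<union> {\<gamma> (2 * a) | a. True}"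
proof -
  have conj: "(\<lambda>X\<in>carrier G2. normal_form c d \<otimes>\<^bsub>G2\<^esub> X \<otimes>\<^bsub>G2\<^esub> inv\<^bsub>G2\<^esub> normal_form c d) =
      tri_map (parity_sign d) (2 * c) 1" for c d
  proof (rule G2_ext)
    \<comment> \<open>The first exponent of the conjugate is (-1)^d a + (1 - (-1)^b) c; the shift is
      0 for even b and 2c for odd b, just as in \<open>tri_map_normal_form\<close>.\<close>
    show "(\<lambda>X\<in>carrier G2. normal_form c d \<otimes>\<^bsub>G2\<^esub> X \<otimes>\<^bsub>G2\<^esub> inv\<^bsub>G2\<^esub> normal_form c d) (normal_form a b) =
      tri_map (parity_sign d) (2 * c) 1 (normal_form a b)" for a b
      by (auto simp: normal_form_inv tri_map_normal_form parity_sign_def)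
  qed (auto intro: tri_map_extensional)
  have conj': "tri_map (parity_sign d) (2 * c) 1 = (if even d then \<gamma> (2 * c) else \<beta> (2 * c))" for c d
    by (simp add: \<beta>_def \<gamma>_def parity_sign_def)
  have Inn: "\<phi> \<in> Inn G2 \<longleftrightarrow> (\<exists>c d::int. \<phi> = (if even d then \<gamma> (2 * c) else \<beta> (2 * c)))" for \<phi>
    unfolding conj'[symmetric] conj[symmetric] Inn_def mem_Collect_eq
    by (metis normal_form_exists normal_form_closed)
  show ?thesis
  proof (rule Set.set_eqI, rule iffI)
    fix \<phi> assume "\<phi> \<in> Inn G2"
    then show "\<phi> \<in> {\<beta> (2 * a) | a. True} \<union> {\<gamma> (2 * a) | a. True}"
      unfolding Inn Un_iff mem_Collect_eq by metis
  next
    fix \<phi> assume "\<phi> \<in> {\<beta> (2 * a) | a. True} \<union> {\<gamma> (2 * a) | a. True}"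
    then obtain c where "\<phi> = \<beta> (2 * c) \<or> \<phi> = \<gamma> (2 * c)"
      unfolding Un_iff mem_Collect_eq by metis
    then show "\<phi> \<in> Inn G2"
      \<comment> \<open>Only the parity of d matters: d = 0 yields \<gamma> and d = 1 yields
        \<beta>.\<close>
      unfolding Inn by (metis even_zero odd_one)
  qed
qed

section \<open>Generating sets\<close>

lemma \<gamma>_pow: "\<gamma> a [^]\<^bsub>AutoGroup G2\<^esub> (n::int) = \<gamma> (a * n)"
proof -
  have "\<gamma> a [^]\<^bsub>AutoGroup G2\<^esub> (k::nat) = \<gamma> (a * int k)" for k
    by (induction k) (simp_all add: AutoGroup_one family_mult algebra_simps)
  then show ?thesis
    by (cases n rule: int_cases2)
      (simp_all add: int_pow_int Aut.int_pow_neg_int family_closed inv_family)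
qed

text \<open>The product of \<open>\<alpha> 1\<close> and \<open>\<alpha> 0\<close> is
  \<open>\<gamma> 1\<close>, whose powers are all \<open>\<gamma> a\<close>. Left multiplication by
  \<open>\<gamma> a\<close> carries index 0 to index a in the other families, with
  \<open>\<delta> 0\<close> obtained from \<open>\<alpha> 0\<close> and
  \<open>\<beta> 0\<close>.\<close>

lemma generate_AutoGroup_G2:
  "generate (AutoGroup G2) {\<alpha> 0, \<alpha> 1, \<beta> 0, \<beta> 1} = carrier (AutoGroup G2)" (is "generate ?A ?S = _")
proof
  have S: "?S \<subseteq> carrier ?A" by (simp add: family_closed)
  then show "generate ?A ?S \<subseteq> carrier ?A" by (rule Aut.generate_incl)
  have gens: "\<alpha> 0 \<in> generate ?A ?S" "\<alpha> 1 \<in> generate ?A ?S" "\<beta> 0 \<in> generate ?A ?S"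
    by (auto intro: generate.incl)
  have "\<gamma> 1 \<in> generate ?A ?S" "\<delta> 0 \<in> generate ?A ?S"
    using generate.eng[OF gens(2,1)] generate.eng[OF gens(1,3)] by (simp_all add: family_mult)
  moreover have \<gamma>: "\<gamma> a \<in> generate ?A ?S" for a
    using Aut.subgroup_int_pow_closed[OF Aut.generate_is_subgroup[OF S] calculation(1), of a]
    by (simp add: \<gamma>_pow)
  ultimately have "\<alpha> a \<in> generate ?A ?S" "\<beta> a \<in> generate ?A ?S" "\<delta> a \<in> generate ?A ?S" for a
    using generate.eng[OF \<gamma>[of a] gens(1)] generate.eng[OF \<gamma>[of a] gens(3)]
      generate.eng[OF \<gamma>[of a], of "\<delta> 0"] by (simp_all add: family_mult)
  with \<gamma> show "carrier ?A \<subseteq> generate ?A ?S"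
    by (auto simp: carrier_AutoGroup_G2)
qed

text \<open>Here \<open>\<gamma> 2\<close> stands for the square of \<open>\<alpha> 1\<close>. Sums
  and differences of even indices are even, so \<open>Inn G2\<close> is a subgroup; conversely,
  powers of \<open>\<gamma> 2\<close> give every \<open>\<gamma> (2 * a)\<close>, and multiplying
  these by \<open>\<beta> 0\<close> gives the rest.\<close>

lemma generate_Inn_G2: "generate (AutoGroup G2) {\<gamma> 2, \<beta> 0} = Inn G2" (is "generate ?A ?S = _")
proof
  have S: "?S \<subseteq> carrier ?A" by (simp add: family_closed)
  have even_mem: "\<beta> a \<in> Inn G2" "\<gamma> a \<in> Inn G2" if "even a" for a
    using that unfolding Inn_G2 by fast+
  have Inn_cases: "(\<exists>a. \<phi> = \<beta> (2 * a)) \<or> (\<exists>a. \<phi> = \<gamma> (2 * a))" if "\<phi> \<in> Inn G2" for \<phi>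
    using that by (simp add: Inn_G2)
  have "subgroup (Inn G2) ?A"
  proof (rule Aut.subgroupI)
    show "Inn G2 \<subseteq> carrier ?A"
    proof
      fix \<phi> assume "\<phi> \<in> Inn G2"
      from Inn_cases[OF this] show "\<phi> \<in> carrier ?A"
        by (elim disjE exE) (simp_all add: family_closed)
    qed
    show "Inn G2 \<noteq> {}" using even_mem(1)[of 0] by auto
  next
    fix \<phi> assume "\<phi> \<in> Inn G2"
    from Inn_cases[OF this] show "inv\<^bsub>?A\<^esub> \<phi> \<in> Inn G2"
      by (elim disjE exE) (simp_all add: inv_family even_mem)
  next
    fix \<phi> \<psi> assume "\<phi> \<in> Inn G2" "\<psi> \<in> Inn G2"
    from this[THEN Inn_cases] show "\<phi> \<otimes>\<^bsub>?A\<^esub> \<psi> \<in> Inn G2"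
      by (elim disjE exE) (simp_all add: family_mult even_mem)
  qed
  moreover have "?S \<subseteq> Inn G2"
    by (simp add: even_mem)
  ultimately show "generate ?A ?S \<subseteq> Inn G2"
    by (rule Aut.generate_subgroup_incl[rotated])
  have gens: "\<gamma> 2 \<in> generate ?A ?S" "\<beta> 0 \<in> generate ?A ?S"
    by (auto intro: generate.incl)
  have \<gamma>: "\<gamma> (2 * a) \<in> generate ?A ?S" for a
    using Aut.subgroup_int_pow_closed[OF Aut.generate_is_subgroup[OF S] gens(1), of a]
    by (simp add: \<gamma>_pow)
  have "\<beta> (2 * a) \<in> generate ?A ?S" for a
    using generate.eng[OF \<gamma>[of a] gens(2)] by (simp add: family_mult)
  with \<gamma> show "Inn G2 \<subseteq> generate ?A ?S"
    using Inn_cases by (metis subsetI)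
qed

theorem theorem3p2:
  shows "carrier (AutoGroup G2) = range \<alpha> \<union> range \<beta> \<union> range \<gamma> \<union> range \<delta>
    \<and> Inn G2 = {\<beta> (2 * a) | a. True} \<union> {\<gamma> (2 * a) | a. True}
    \<and> (\<forall>a b c d a' b' c' d' :: int.
        \<alpha> a \<circ>\<^sub>2 \<alpha> a' = \<gamma> (a + a') \<and> \<alpha> a \<circ>\<^sub>2 \<beta> b' = \<delta> (a + b') \<and>
        \<alpha> a \<circ>\<^sub>2 \<gamma> c' = \<alpha> (a + c') \<and> \<alpha> a \<circ>\<^sub>2 \<delta> d' = \<beta> (a + d') \<and>
        \<beta> b \<circ>\<^sub>2 \<alpha> a' = \<delta> (b - a') \<and> \<beta> b \<circ>\<^sub>2 \<beta> b' = \<gamma> (b - b') \<and>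
        \<beta> b \<circ>\<^sub>2 \<gamma> c' = \<beta> (b - c') \<and> \<beta> b \<circ>\<^sub>2 \<delta> d' = \<alpha> (b - d') \<and>
        \<gamma> c \<circ>\<^sub>2 \<alpha> a' = \<alpha> (c + a') \<and> \<gamma> c \<circ>\<^sub>2 \<beta> b' = \<beta> (c + b') \<and>
        \<gamma> c \<circ>\<^sub>2 \<gamma> c' = \<gamma> (c + c') \<and> \<gamma> c \<circ>\<^sub>2 \<delta> d' = \<delta> (c + d') \<and>
        \<delta> d \<circ>\<^sub>2 \<alpha> a' = \<beta> (d - a') \<and> \<delta> d \<circ>\<^sub>2 \<beta> b' = \<alpha> (d - b') \<and>
        \<delta> d \<circ>\<^sub>2 \<gamma> c' = \<delta> (d - c') \<and> \<delta> d \<circ>\<^sub>2 \<delta> d' = \<gamma> (d - d'))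
    \<and> carrier (AutoGroup G2) = generate (AutoGroup G2) {\<alpha> 0, \<alpha> 1, \<beta> 0, \<beta> 1}
    \<and> Inn G2 = generate (AutoGroup G2) {\<alpha> 1 [^]\<^bsub>AutoGroup G2\<^esub> (2::nat), \<beta> 0}"
proof -
  have "\<alpha> 1 [^]\<^bsub>AutoGroup G2\<^esub> (2::nat) = \<gamma> 2"
    by (simp add: numeral_2_eq_2 family_closed family_mult)
  then show ?thesis
    using carrier_AutoGroup_G2 Inn_G2 generate_AutoGroup_G2 generate_Inn_G2
    by (simp add: family_compose)
qed

end
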